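(* For every $\beta\in[0,0.5]$, the beta PDA-rule $F_\beta$ is a distortion-free PDA-rule: for every language model $P_M$, every token sequence $x_{1:n}$ and every $i\le n$, $$P_M(x_i\mid x_{1:i-1})=\mathbb{E}_{k_i}\big[F_\beta(P_M(\cdot\mid x_{1:i-1}),k_i)(x_i)\big].$$
   Context: $V$ is a finite token set with $|V|=N$, and $\mathcal{P}$ is the set of probability distributions on $V$. A language model $P_M$ assigns to each finite token sequence $x_{1:i-1}$ a next-token distribution $P_M(\cdot\mid x_{1:i-1})\in\mathcal{P}$. $\mathbb{E}_k$ is expectation over a random watermark key $k$; over the random key, $\pi(\cdot\mid k):V\to\{1,\dots,N\}$ is a uniformly random bijection. The permute-reweight rule is $$F_{PR}(P,k)(t)=\max\Big\{2\!\!\sum_{t':\pi(t'|k)\le\pi(t|k)}\!\!P(t')-1,0\Big\}-\max\Big\{2\!\!\sum_{t':\pi(t'|k)\le\pi(t|k)-1}\!\!P(t')-1,0\Big\},$$ and the beta PDA-rule with parameter $\beta\in[0,0.5]$ is $$F_\beta(P,k)(t)=(1-\beta)F_{PR}(P,k)(t)+\beta\Big[\max\Big\{2\!\!\sum_{t':\pi(t'|k)\ge\pi(t|k)}\!\!P(t')-1,0\Big\}-\max\Big\{2\!\!\sum_{t':\pi(t'|k)\ge\pi(t|k)+1}\!\!P(t')-1,0\Big\}\Big].$$ *)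

theory Defs
  imports "HOL-Probability.Probability"
begin

text \<open>The token set is the universe of a type of class \<open>finite\<close>, so \<open>N = CARD('v)\<close>, and
  \<open>'v pmf\<close> is the set of probability distributions on it. A language model maps the
  preceding tokens, as a list, to the distribution of the next token.\<close>

type_synonym 'v language_model = "'v list \<Rightarrow> 'v pmf"

definition token_bijections :: "('v::finite \<Rightarrow> nat) set" where
  "token_bijections = {\<sigma>. bij_betw \<sigma> UNIV {1..CARD('v)}}"

text \<open>\<open>M\<close> is the law of the watermark key; \<open>\<pi> k\<close> is the bijection determined by the key \<open>k\<close>.\<close>

definition uniform_random_bijection :: "'k measure \<Rightarrow> ('k \<Rightarrow> 'v::finite \<Rightarrow> nat) \<Rightarrow> bool" where
  "uniform_random_bijection M \<pi> \<longleftrightarrow>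
     \<pi> \<in> measurable M (count_space token_bijections) \<and>
     distr M (count_space token_bijections) \<pi> = uniform_count_measure token_bijections"

text \<open>Positions start at 1, so the truncated subtraction \<open>\<pi> k t - 1\<close> below is harmless: it is 0,
  giving an empty sum, exactly when \<open>t\<close> comes first.\<close>

definition F_PR :: "('k \<Rightarrow> 'v::finite \<Rightarrow> nat) \<Rightarrow> 'v pmf \<Rightarrow> 'k \<Rightarrow> 'v \<Rightarrow> real" where
  "F_PR \<pi> P k t =
     max (2 * (\<Sum>t' | \<pi> k t' \<le> \<pi> k t. pmf P t') - 1) 0
     - max (2 * (\<Sum>t' | \<pi> k t' \<le> \<pi> k t - 1. pmf P t') - 1) 0"

definition F_beta :: "real \<Rightarrow> ('k \<Rightarrow> 'v::finite \<Rightarrow> nat) \<Rightarrow> 'v pmf \<Rightarrow> 'k \<Rightarrow> 'v \<Rightarrow> real" where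
  "F_beta \<beta> \<pi> P k t =
     (1 - \<beta>) * F_PR \<pi> P k t
     + \<beta> * (max (2 * (\<Sum>t' | \<pi> k t' \<ge> \<pi> k t. pmf P t') - 1) 0
            - max (2 * (\<Sum>t' | \<pi> k t' \<ge> \<pi> k t + 1. pmf P t') - 1) 0)"

text \<open>A PDA-rule turns a distribution and a key into a distribution, the latter given by its
  mass function.\<close>

definition PDA_rule :: "'k set \<Rightarrow> ('v::finite pmf \<Rightarrow> 'k \<Rightarrow> 'v \<Rightarrow> real) \<Rightarrow> bool" where
  "PDA_rule K F \<longleftrightarrow> (\<forall>P. \<forall>k\<in>K. \<exists>Q. F P k = pmf Q)"

text \<open>Token \<open>i\<close> (counting from 1) of \<open>x\<close> is \<open>x ! (i - 1)\<close>, and its prefix is \<open>take (i - 1) x\<close>.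
  Integrability is demanded because the Bochner integral of a non-integrable function is 0
  by convention.\<close>

definition distortion_free_PDA_rule ::
    "'k measure \<Rightarrow> ('v::finite pmf \<Rightarrow> 'k \<Rightarrow> 'v \<Rightarrow> real) \<Rightarrow> bool" where
  "distortion_free_PDA_rule M F \<longleftrightarrow>
     PDA_rule (space M) F \<and>
     (\<forall>(P\<^sub>M :: 'v language_model) (x :: 'v list). \<forall>i\<in>{1..length x}.
        integrable M (\<lambda>k. F (P\<^sub>M (take (i - 1) x)) k (x ! (i - 1))) \<and>
        pmf (P\<^sub>M (take (i - 1) x)) (x ! (i - 1))
          = (\<integral>k. F (P\<^sub>M (take (i - 1) x)) k (x ! (i - 1)) \<partial>M))"

end

(* Reversing the order of the tokens turns the second summand of F_beta into F_PR.  As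
   max (2 s - 1) 0 - max (2 (1 - s) - 1) 0 = 2 s - 1, the values of F_PR at t for an order and for
   its reverse add up to twice the probability of t.  A uniformly random order and its reverse
   have the same law, so each of the two values has the probability of t as its mean. *)

theory Submission
  imports Defs
begin

text \<open>Positions run from 1 to \<open>CARD('v)\<close>, so subtracting from
  \<open>Suc CARD('v)\<close> exchanges the first and last positions, stays in the same range, and
  never truncates on \<open>token_bijections\<close>.\<close>

definition reverse_order :: "('v::finite \<Rightarrow> nat) \<Rightarrow> 'v \<Rightarrow> nat" where
  "reverse_order \<sigma> t = Suc CARD('v) - \<sigma> t"

lemma token_bijections_bounds:
  fixes \<sigma> :: "'v::finite \<Rightarrow> nat"
  assumes "\<sigma> \<in> token_bijections"
  shows "1 \<le> \<sigma> t" "\<sigma> t \<le> CARD('v)"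
  using bij_betwE[of \<sigma> UNIV "{1..CARD('v)}"] assms by (auto simp: token_bijections_def)

lemma reverse_order_in_token_bijections:
  fixes \<sigma> :: "'v::finite \<Rightarrow> nat"
  assumes "\<sigma> \<in> token_bijections"
  shows "reverse_order \<sigma> \<in> token_bijections"
proof -
  have "bij_betw (\<lambda>j. Suc CARD('v) - j) {1..CARD('v)} {1..CARD('v)}"
    by (rule bij_betwI[where g = "\<lambda>j. Suc CARD('v) - j"]) auto
  with assms have "bij_betw ((\<lambda>j. Suc CARD('v) - j) \<circ> \<sigma>) UNIV {1..CARD('v)}"
    unfolding token_bijections_def by (blast intro: bij_betw_trans)
  then show ?thesis
    by (simp add: token_bijections_def reverse_order_def[abs_def] o_def)
qed

lemma reverse_order_reverse_order:
  assumes "\<sigma> \<in> token_bijections"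
  shows "reverse_order (reverse_order \<sigma>) = \<sigma>"
  using token_bijections_bounds[OF assms] by (auto simp: reverse_order_def fun_eq_iff le_SucI)

lemma bij_betw_reverse_order:
  "bij_betw reverse_order token_bijections token_bijections"
  by (rule bij_betwI[where g = reverse_order])
    (auto intro: reverse_order_in_token_bijections reverse_order_reverse_order)

lemma finite_token_bijections:
  "finite (token_bijections :: ('v::finite \<Rightarrow> nat) set)"
proof (rule finite_subset)
  \<comment> \<open>Extensionality is vacuous on the domain \<open>UNIV\<close>, so only the range
    matters here.\<close>
  show "token_bijections \<subseteq> (UNIV :: 'v set) \<rightarrow>\<^sub>E {1..CARD('v)}"
    by (auto simp: token_bijections_def bij_betw_def)
qed (simp add: finite_PiE)

lemma token_bijections_nonempty:
  "(token_bijections :: ('v::finite \<Rightarrow> nat) set) \<noteq> {}"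
proof -
  obtain h :: "'v \<Rightarrow> nat" where "bij_betw h UNIV {1..CARD('v)}"
    using finite_same_card_bij[of "UNIV :: 'v set" "{1..CARD('v)}"] by auto
  then show ?thesis by (auto simp: token_bijections_def)
qed

text \<open>With \<open>\<pi> = id\<close> the key is the bijection itself.\<close>

lemma F_beta_eq:
  fixes \<pi> :: "'k \<Rightarrow> 'v::finite \<Rightarrow> nat"
  assumes "\<pi> k \<in> token_bijections"
  shows "F_beta \<beta> \<pi> P k t =
    (1 - \<beta>) * F_PR id P (\<pi> k) t + \<beta> * F_PR id P (reverse_order (\<pi> k)) t"
proof -
  let ?\<rho> = "reverse_order (\<pi> k)"
  note b = token_bijections_bounds[OF assms]
  \<comment> \<open>If \<open>t\<close> is last in the order \<open>\<pi> k\<close>, then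
    \<open>?\<rho> t - 1\<close> is 0; both sides of the second equivalence are false, since
    reversed positions are at least 1.\<close>
  have "?\<rho> t' \<le> ?\<rho> t \<longleftrightarrow> \<pi> k t \<le> \<pi> k t'"
    and "?\<rho> t' \<le> ?\<rho> t - 1 \<longleftrightarrow> \<pi> k t + 1 \<le> \<pi> k t'" for t'
    using b[of t] b[of t'] by (auto simp: reverse_order_def)
  then show ?thesis by (simp add: F_beta_def F_PR_def)
qed

lemma F_PR_nonneg: "F_PR \<pi> P k t \<ge> 0"
proof -
  have "(\<Sum>t' | \<pi> k t' \<le> \<pi> k t - 1. pmf P t') \<le> (\<Sum>t' | \<pi> k t' \<le> \<pi> k t. pmf P t')"
    by (intro sum_mono2) auto
  then show ?thesis by (auto simp: F_PR_def)
qed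

lemma sum_pmf_UNIV: "(\<Sum>t\<in>UNIV. pmf P (t :: 'v::finite)) = 1"
  by (rule sum_pmf_eq_1) auto

text \<open>Taken in the order of positions, the values are the successive increments of one
  truncated function of the cumulative mass, so their sum telescopes.\<close>

lemma sum_F_PR:
  fixes P :: "'v::finite pmf"
  assumes "\<sigma> \<in> token_bijections"
  shows "(\<Sum>t\<in>UNIV. F_PR id P \<sigma> t) = 1"
proof -
  define G where "G j = max (2 * (\<Sum>t' | \<sigma> t' \<le> j. pmf P t') - 1) 0" for j
  note b = token_bijections_bounds[OF assms]
  have "(\<Sum>t\<in>UNIV. F_PR id P \<sigma> t) = (\<Sum>t\<in>UNIV. G (\<sigma> t) - G (\<sigma> t - 1))"
    by (simp add: F_PR_def G_def)
  also have "\<dots> = (\<Sum>j=1..CARD('v). G j - G (j - 1))"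
    using assms by (intro sum.reindex_bij_betw) (simp add: token_bijections_def)
  also have "\<dots> = G CARD('v) - G 0"
    using sum_telescope''[of 0 "CARD('v)" G] by (simp add: atLeastSucAtMost_greaterThanAtMost)
  also have "\<dots> = 1"
  proof -
    \<comment> \<open>The full mass gives \<open>max (2 * 1 - 1) 0 = 1\<close>, and the empty sum
      gives \<open>max (2 * 0 - 1) 0 = 0\<close>.\<close>
    have "{t'. \<sigma> t' \<le> CARD('v)} = UNIV" "{t'. \<sigma> t' \<le> 0} = {}"
      using b by (auto simp: Suc_le_eq)
    then show ?thesis unfolding G_def by (simp only: sum_pmf_UNIV sum.empty)
  qed
  finally show ?thesis .
qed

text \<open>Let p be the mass of \<open>t\<close>, s the mass strictly before it, and g(u) = max (2
  u - 1) 0. The two values are g(s + p) - g(s) and g(1 - s) - g(1 - s - p). Since g(u) - g(1 - u) =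
  2 u - 1, pairing terms across them gives (2 (s + p) - 1) - (2 s - 1) = 2 p.\<close>

lemma F_PR_add_reverse_order:
  fixes P :: "'v::finite pmf"
  assumes "\<sigma> \<in> token_bijections"
  shows "F_PR id P \<sigma> t + F_PR id P (reverse_order \<sigma>) t = 2 * pmf P t"
proof -
  let ?\<rho> = "reverse_order \<sigma>"
  note b = token_bijections_bounds[OF assms]
  have inj: "\<sigma> t' = \<sigma> t \<longleftrightarrow> t' = t" for t'
    using assms by (auto simp: token_bijections_def bij_betw_def inj_on_def)
  have below: "{t'. \<sigma> t' \<le> \<sigma> t} = insert t {t'. \<sigma> t' \<le> \<sigma> t - 1}"
    and above: "{t'. ?\<rho> t' \<le> ?\<rho> t} = - {t'. \<sigma> t' \<le> \<sigma> t - 1}"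
    and strictly_above: "{t'. ?\<rho> t' \<le> ?\<rho> t - 1} = - {t'. \<sigma> t' \<le> \<sigma> t}"
  proof -
    have "\<sigma> t' \<le> \<sigma> t \<longleftrightarrow> t' = t \<or> \<sigma> t' \<le> \<sigma> t - 1"
      and "?\<rho> t' \<le> ?\<rho> t \<longleftrightarrow> \<not> \<sigma> t' \<le> \<sigma> t - 1"
      and "?\<rho> t' \<le> ?\<rho> t - 1 \<longleftrightarrow> \<not> \<sigma> t' \<le> \<sigma> t" for t'
      using b[of t] b[of t'] inj[of t'] by (auto simp: reverse_order_def)
    then show "{t'. \<sigma> t' \<le> \<sigma> t} = insert t {t'. \<sigma> t' \<le> \<sigma> t - 1}"
      and "{t'. ?\<rho> t' \<le> ?\<rho> t} = - {t'. \<sigma> t' \<le> \<sigma> t - 1}"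
      and "{t'. ?\<rho> t' \<le> ?\<rho> t - 1} = - {t'. \<sigma> t' \<le> \<sigma> t}" by auto
  qed
  have compl: "sum (pmf P) (- A) = 1 - sum (pmf P) A" for A
    using sum.subset_diff[of A UNIV "pmf P"] by (simp add: sum_pmf_UNIV Compl_eq_Diff_UNIV)
  have "sum (pmf P) {t'. \<sigma> t' \<le> \<sigma> t} = pmf P t + sum (pmf P) {t'. \<sigma> t' \<le> \<sigma> t - 1}"
    \<comment> \<open>Because \<open>\<sigma> t\<close> is at least 1, \<open>\<sigma> t - 1\<close>
      is strictly smaller, so \<open>t\<close> is not already in the set into which it is
      inserted.\<close>
    unfolding below using b(1)[of t] by (subst sum.insert) auto
  then show ?thesis
    unfolding F_PR_def id_apply above strictly_above compl by (simp add: max_def)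
qed

text \<open>Reversal permutes the finite set of orders, so the two sums agree. By the pairing of
  each order with its reverse they add up to \<open>2 * card S * pmf P t\<close>, hence each is half
  of that.\<close>

lemma
  fixes P :: "'v::finite pmf"
  defines "S \<equiv> token_bijections :: ('v \<Rightarrow> nat) set"
  shows sum_F_PR_token_bijections: "(\<Sum>\<sigma>\<in>S. F_PR id P \<sigma> t) = card S * pmf P t"
    and sum_F_PR_reverse_order: "(\<Sum>\<sigma>\<in>S. F_PR id P (reverse_order \<sigma>) t) = card S * pmf P t"
proof -
  have reverse: "(\<Sum>\<sigma>\<in>S. F_PR id P (reverse_order \<sigma>) t) = (\<Sum>\<sigma>\<in>S. F_PR id P \<sigma> t)"
    unfolding S_def by (rule sum.reindex_bij_betw[OF bij_betw_reverse_order])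
  have "(\<Sum>\<sigma>\<in>S. F_PR id P \<sigma> t) + (\<Sum>\<sigma>\<in>S. F_PR id P (reverse_order \<sigma>) t)
      = (\<Sum>\<sigma>\<in>S. 2 * pmf P t)"
    by (simp add: S_def F_PR_add_reverse_order flip: sum.distrib)
  with reverse show "(\<Sum>\<sigma>\<in>S. F_PR id P \<sigma> t) = card S * pmf P t"
    and "(\<Sum>\<sigma>\<in>S. F_PR id P (reverse_order \<sigma>) t) = card S * pmf P t"
    by simp_all
qed

text \<open>The integrand sees the key only through \<open>\<pi> k\<close>, so a change of variables
  to the uniform law on a finite set turns the integral into an average.\<close>

lemma
  fixes \<pi> :: "'k \<Rightarrow> 'v::finite \<Rightarrow> nat" and f :: "('v \<Rightarrow> nat) \<Rightarrow> real"
  assumes "uniform_random_bijection M \<pi>"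
  shows integrable_uniform_random_bijection: "integrable M (\<lambda>k. f (\<pi> k))"
    and integral_uniform_random_bijection: "(\<integral>k. f (\<pi> k) \<partial>M)
      = (\<Sum>\<sigma>\<in>token_bijections. f \<sigma>) / card (token_bijections :: ('v \<Rightarrow> nat) set)"
proof -
  let ?S = "token_bijections :: ('v \<Rightarrow> nat) set"
  have m: "\<pi> \<in> measurable M (count_space ?S)"
    and d: "distr M (count_space ?S) \<pi> = uniform_count_measure ?S"
    using assms by (auto simp: uniform_random_bijection_def)
  have "integrable (distr M (count_space ?S) \<pi>) f"
    unfolding d uniform_count_measure_def
    by (rule integrable_point_measure_finite[OF finite_token_bijections])
  then show "integrable M (\<lambda>k. f (\<pi> k))"
    using integrable_distr[OF m] by blast
  have "(\<integral>k. f (\<pi> k) \<partial>M) = integral\<^sup>L (uniform_count_measure ?S) f"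
    using integral_distr[OF m, of f] by (simp add: d)
  also have "\<dots> = sum f ?S / card ?S"
    by (rule integral_uniform_count_measure[OF finite_token_bijections])
  finally show "(\<integral>k. f (\<pi> k) \<partial>M) = sum f ?S / card ?S" .
qed

lemma exists_pmf_eq:
  fixes f :: "'v::finite \<Rightarrow> real"
  assumes "\<And>t. f t \<ge> 0" and "(\<Sum>t\<in>UNIV. f t) = 1"
  shows "\<exists>Q. f = pmf Q"
proof -
  have "(\<integral>\<^sup>+t. ennreal (f t) \<partial>count_space UNIV) = 1"
    using assms by (simp add: nn_integral_count_space_finite sum_ennreal)
  then have "pmf (embed_pmf f) t = f t" for t
    using assms(1) by (rule pmf_embed_pmf[rotated])
  then show ?thesis by (intro exI[of _ "embed_pmf f"]) (auto simp: fun_eq_iff)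
qed

text \<open>For each key the rule is a convex combination of two mass functions, one for the order
  and one for its reverse.\<close>

lemma PDA_rule_F_beta:
  assumes "\<And>k. k \<in> K \<Longrightarrow> \<pi> k \<in> token_bijections" and "\<beta> \<in> {0..1}"
  shows "PDA_rule K (F_beta \<beta> \<pi>)"
  unfolding PDA_rule_def
proof (intro allI ballI exists_pmf_eq)
  fix P k t assume k: "k \<in> K"
  show "F_beta \<beta> \<pi> P k t \<ge> 0"
    using assms(2) by (simp add: F_beta_eq[of \<pi> k] assms(1)[OF k] F_PR_nonneg)
  show "(\<Sum>t\<in>UNIV. F_beta \<beta> \<pi> P k t) = 1"
    by (simp add: F_beta_eq[of \<pi> k] assms(1)[OF k] sum.distrib sum_F_PR
        reverse_order_in_token_bijections flip: sum_distrib_left)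
qed

theorem theorem5p2:
  fixes M :: "'k measure" and \<pi> :: "'k \<Rightarrow> 'v::finite \<Rightarrow> nat" and \<beta> :: real
  assumes "prob_space M"
    and "uniform_random_bijection M \<pi>"
    and "\<beta> \<in> {0..1/2}"
  shows "distortion_free_PDA_rule M (F_beta \<beta> \<pi>)"
proof -
  let ?S = "token_bijections :: ('v \<Rightarrow> nat) set"
  have \<pi>: "\<pi> k \<in> ?S" if "k \<in> space M" for k
    using assms(2) that by (auto simp: uniform_random_bijection_def dest: measurable_space)
  have pda: "PDA_rule (space M) (F_beta \<beta> \<pi>)"
    using \<pi> assms(3) by (intro PDA_rule_F_beta) auto
  \<comment> \<open>A language model and a token sequence enter only through one distribution and
    one token, so arbitrary \<open>P\<close> and \<open>t\<close> cover every prefix.\<close>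
  have "integrable M (\<lambda>k. F_beta \<beta> \<pi> P k t) \<and> pmf P t = (\<integral>k. F_beta \<beta> \<pi> P k t \<partial>M)" for P t
  proof -
    define f where
      "f \<sigma> = (1 - \<beta>) * F_PR id P \<sigma> t + \<beta> * F_PR id P (reverse_order \<sigma>) t" for \<sigma>
    have eq: "F_beta \<beta> \<pi> P k t = f (\<pi> k)" if "k \<in> space M" for k
      unfolding f_def using \<pi>[OF that] by (rule F_beta_eq)
    \<comment> \<open>\<open>eq\<close> is available only on \<open>space M\<close>, which is all
      that integrability and the integral depend on.\<close>
    have "integrable M (\<lambda>k. F_beta \<beta> \<pi> P k t) \<longleftrightarrow> integrable M (\<lambda>k. f (\<pi> k))"
      by (intro Bochner_Integration.integrable_cong) (auto simp: eq)
    moreover have "(\<integral>k. F_beta \<beta> \<pi> P k t \<partial>M) = (\<integral>k. f (\<pi> k) \<partial>M)"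
      by (intro Bochner_Integration.integral_cong) (auto simp: eq)
    \<comment> \<open>Both orders contribute the same total, and the weights
      \<open>1 - \<beta>\<close> and \<open>\<beta>\<close> add up to 1.\<close>
    moreover have "sum f ?S = (1 - \<beta>) * (card ?S * pmf P t) + \<beta> * (card ?S * pmf P t)"
      by (simp add: f_def sum.distrib sum_F_PR_token_bijections sum_F_PR_reverse_order
          flip: sum_distrib_left)
    then have "sum f ?S / card ?S = pmf P t"
      using token_bijections_nonempty[where 'v = 'v] finite_token_bijections[where 'v = 'v]
      by (simp add: field_simps)
    ultimately show ?thesis
      by (simp add: integrable_uniform_random_bijection[OF assms(2)]
          integral_uniform_random_bijection[OF assms(2)])
  qed
  with pda show ?thesis by (simp add: distortion_free_PDA_rule_def)
qed

end
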